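(* Let $\ell \ge 1$ and $a_1,\dots,a_\ell$ be nonnegative integers, let $G = \{*L_{a_1}, \ldots, *L_{a_\ell}\}$, and let $a = \operatorname{mex}(\{a_1, \ldots, a_\ell\})$. Then $G \equiv *L_{a}$.
   Context: Positions are defined recursively: $*L$ and $*R$ are terminal positions; if $G_1,\dots,G_n$ ($n\ge 1$) are positions, then $\{G_1,\dots,G_n\}$ is a position with options $G_1,\dots,G_n$. All positions have finite game trees. Play: Left and Right move alternately, each choosing any option of the current position; when a terminal position is reached, Left wins if it is $*L$ and Right wins if it is $*R$. Disjunctive sum: $*L + *L = *R + *R = *L$, $*L + *R = *R + *L = *R$; if at least one of $G,H$ is non-terminal, $G+H$ has options all $G'+H$ ($G'$ an option of $G$) and all $G+H'$ ($H'$ an option of $H$). Outcome classes: $\mathcal{L}$ (Left wins moving first or second), $\mathcal{R}$ (Right wins moving first or second), $\mathcal{N}$ (first player wins), $\mathcal{P}$ (second player wins); $o(G)$ denotes the outcome class. Equivalence: $G \equiv H$ iff $o(G+X) = o(H+X)$ for every position $X$. Define $*L_0 = *L$ and $*L_n = \{*L_{n-1}, \ldots, *L_0\}$ for $n \ge 1$. For a set $S$ of nonnegative integers, $\operatorname{mex}(S)$ is the least nonnegative integer not in $S$. *)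

theory Defs
  imports Main "HOL-Library.FSet"
begin

datatype player = Left | Right

fun opponent :: "player \<Rightarrow> player" where
  "opponent Left = Right"
| "opponent Right = Left"

text \<open>
  \<open>Terminal Left\<close> is $*L$, \<open>Terminal Right\<close> is $*R$, and \<open>Node Gs\<close> is the game whose options are
  the elements of \<open>Gs\<close>. The datatype also contains \<open>Node {||}\<close>, which is not a position;
  the predicate \<open>position\<close> below excludes it hereditarily.
\<close>

datatype game = Terminal player | Node "game fset"

inductive position :: "game \<Rightarrow> bool" where
  "position (Terminal p)"
| "Gs \<noteq> {||} \<Longrightarrow> (\<And>G. G |\<in>| Gs \<Longrightarrow> position G) \<Longrightarrow> position (Node Gs)"

lemma size_option_less:
  "G |\<in>| Gs \<Longrightarrow> size G < size (Node Gs)"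
proof -
  assume "G |\<in>| Gs"
  then have "Suc (size G) \<le> (\<Sum>x\<in>fset Gs. Suc (size x))"
    by (intro member_le_sum) auto
  then show ?thesis by simp
qed

text \<open>
  \<open>wins w p G\<close>: the player \<open>w\<close> has a winning strategy in \<open>G\<close> when \<open>p\<close> is the next to move.
\<close>

function wins :: "player \<Rightarrow> player \<Rightarrow> game \<Rightarrow> bool" where
  "wins w p (Terminal q) \<longleftrightarrow> q = w"
| "wins w p (Node Gs) \<longleftrightarrow>
     (if p = w then (\<exists>G \<in> fset Gs. wins w (opponent p) G)
      else (\<forall>G \<in> fset Gs. wins w (opponent p) G))"
  by pat_completeness auto
termination
  by (relation "measure (\<lambda>(w, p, G). size G)") (auto dest: size_option_less)

lemma wins_determined: "wins Right p G \<longleftrightarrow> \<not> wins Left p G"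
proof (induction G arbitrary: p)
  case (Terminal q)
  then show ?case by (cases q) auto
next
  case (Node Gs)
  then show ?case by (cases p) auto
qed

datatype outcome_class = Class_L | Class_R | Class_N | Class_P

definition outcome :: "game \<Rightarrow> outcome_class" where
  "outcome G =
     (if wins Left Left G \<and> wins Left Right G then Class_L
      else if wins Right Left G \<and> wins Right Right G then Class_R
      else if wins Left Left G \<and> wins Right Right G then Class_N
      else Class_P)"

lemma outcome_iff:
  "outcome G = Class_L \<longleftrightarrow> wins Left Left G \<and> wins Left Right G"
  "outcome G = Class_R \<longleftrightarrow> wins Right Left G \<and> wins Right Right G"
  "outcome G = Class_N \<longleftrightarrow> wins Left Left G \<and> wins Right Right G"
  "outcome G = Class_P \<longleftrightarrow> wins Right Left G \<and> wins Left Right G"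
  by (auto simp: outcome_def wins_determined)

function game_sum :: "game \<Rightarrow> game \<Rightarrow> game" (infixl "\<oplus>" 65) where
  "Terminal p \<oplus> Terminal q = Terminal (if p = q then Left else Right)"
| "Terminal p \<oplus> Node Hs = Node ((\<lambda>H. Terminal p \<oplus> H) |`| Hs)"
| "Node Gs \<oplus> Terminal q = Node ((\<lambda>G. G \<oplus> Terminal q) |`| Gs)"
| "Node Gs \<oplus> Node Hs =
     Node (((\<lambda>G. G \<oplus> Node Hs) |`| Gs) |\<union>| ((\<lambda>H. Node Gs \<oplus> H) |`| Hs))"
  by pat_completeness auto
termination
  by (relation "measure (\<lambda>(G, H). size G + size H)") (auto dest: size_option_less)

lemma position_game_sum:
  "position G \<Longrightarrow> position H \<Longrightarrow> position (G \<oplus> H)"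
  by (induction G H rule: game_sum.induct)
     (auto 0 4 elim: position.cases intro!: position.intros)

definition game_equiv :: "game \<Rightarrow> game \<Rightarrow> bool" (infix "\<simeq>" 50) where
  "G \<simeq> H \<longleftrightarrow> (\<forall>X. position X \<longrightarrow> outcome (G \<oplus> X) = outcome (H \<oplus> X))"

function starL :: "nat \<Rightarrow> game" where
  "starL 0 = Terminal Left"
| "starL (Suc n) = Node (starL |`| fset_of_list [0..<Suc n])"
  by pat_completeness auto
termination
  by (relation "measure id") (auto simp: fset_of_list_elem)

lemma position_starL: "position (starL n)"
  by (induction n rule: starL.induct) (auto intro!: position.intros simp: fset_of_list_elem)

lemma position_node_starL:
  "as \<noteq> [] \<Longrightarrow> position (Node (fset_of_list (map starL as)))"
  by (cases as) (auto intro!: position.intros position_starL simp: fset_of_list_elem)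

definition mex :: "nat set \<Rightarrow> nat" where
  "mex S = (LEAST n. n \<notin> S)"

end

theory Submission imports Defs begin

text \<open>
  A player who wins $*L_a + X$ also wins $G + X$ by following the same strategy: a move
  $*L_a \to *L_b$ with $b < a$ is available in $G$ because $a$ is the mex, and an additional
  opposing move $G \to *L_b$ with $b > a$ is reverted at once to $*L_a$. Since games are
  determined, these implications for both players give equality of outcomes. When $X$ is
  terminal and $a = 0$, play in $*L_a + X$ has already ended while $G + X$ goes on, but then all
  leaves of $G + X$ have the same winner as $X$.
\<close>

lemma opponent_if_neq: "p \<noteq> w \<Longrightarrow> opponent p = w"
  by (cases p; cases w) auto

lemma starL_pos: "0 < n \<Longrightarrow> starL n = Node (starL |`| fset_of_list [0..<n])"
  by (cases n) (auto simp del: upt_Suc)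

text \<open>All leaves of \<open>starL n\<close> are \<open>Terminal Left\<close>, which is neutral
  when terminals are added, so every leaf of the sum is \<open>Terminal q\<close>.\<close>

lemma wins_starL_sum_Terminal: "wins w p (starL n \<oplus> Terminal q) \<longleftrightarrow> q = w"
proof (induction n arbitrary: p rule: less_induct)
  case (less n)
  show ?case
  proof (cases "n = 0")
    case True
    then show ?thesis by (cases q) auto
  next
    case False
    with less show ?thesis by (auto simp: starL_pos fset_of_list_elem)
  qed
qed

text \<open>At \<open>n = 0\<close> the first summand has no moves, matching the empty range
  \<open>b < n\<close>, so one formula covers all \<open>n\<close>.\<close>

lemma wins_starL_sum_Node_self:
  "wins w w (starL n \<oplus> Node Xs) \<longleftrightarrow>
     (\<exists>b<n. wins w (opponent w) (starL b \<oplus> Node Xs)) \<or>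
     (\<exists>X. X |\<in>| Xs \<and> wins w (opponent w) (starL n \<oplus> X))"
  by (cases "n = 0") (auto simp: starL_pos fset_of_list_elem)

lemma wins_starL_sum_Node_other:
  assumes "p \<noteq> w"
  shows "wins w p (starL n \<oplus> Node Xs) \<longleftrightarrow>
     (\<forall>b<n. wins w w (starL b \<oplus> Node Xs)) \<and>
     (\<forall>X. X |\<in>| Xs \<longrightarrow> wins w w (starL n \<oplus> X))"
  using assms
  by (cases "n = 0") (auto simp: starL_pos fset_of_list_elem opponent_if_neq)

lemma mex_notin: "finite S \<Longrightarrow> mex S \<notin> S"
  unfolding mex_def by (rule LeastI_ex) (rule ex_new_if_finite[OF infinite_UNIV_nat])

lemma less_mex_in: "n < mex S \<Longrightarrow> n \<in> S"
  unfolding mex_def using not_less_Least by blast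

lemma wins_Node_starL_sum:
  assumes "as \<noteq> []" and "wins w p (starL (mex (set as)) \<oplus> X)"
  shows "wins w p (Node (fset_of_list (map starL as)) \<oplus> X)"
  using assms(2)
proof (induction X arbitrary: p)
  case (Terminal q)
  with assms(1) show ?case
    \<comment> \<open>Every option is won by \<open>q\<close>; nonemptiness of \<open>as\<close>
      guarantees that there is one.\<close>
    by (auto simp: wins_starL_sum_Terminal fset_of_list_elem neq_Nil_conv)
next
  case (Node Xs)
  let ?a = "mex (set as)"
  show ?case
  proof (cases "p = w")
    case True
    with Node.prems consider b where "b < ?a" "wins w (opponent w) (starL b \<oplus> Node Xs)"
      | X where "X |\<in>| Xs" "wins w (opponent w) (starL ?a \<oplus> X)"
      by (auto simp: wins_starL_sum_Node_self)
    then show ?thesis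
    proof cases
      case 1
      with True show ?thesis by (auto simp: fset_of_list_elem dest!: less_mex_in)
    next
      case 2
      with True Node.IH show ?thesis by auto
    qed
  next
    case False
    have reply: "wins w w (starL b \<oplus> Node Xs)" if "b \<in> set as" for b
    proof (cases "b < ?a")
      \<comment> \<open>The opponent could have made this same move from \<open>starL ?a\<close>,
        where \<open>w\<close> wins.\<close>
      case True
      with Node.prems False show ?thesis by (simp add: wins_starL_sum_Node_other)
    next
      case not_less: False
      have "b \<noteq> ?a"
        using that mex_notin[of "set as"] by auto
      with not_less have "?a < b" by simp
      moreover have "opponent w = p"
        using False by (simp add: opponent_if_neq)
      \<comment> \<open>The reply \<open>starL ?a\<close> leaves \<open>p\<close> to move, the
        situation of \<open>Node.prems\<close>.\<close>
      ultimately show ?thesis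
        using Node.prems by (auto simp: wins_starL_sum_Node_self)
    qed
    have "wins w w (Node (fset_of_list (map starL as)) \<oplus> X)" if "X |\<in>| Xs" for X
      using Node that False by (simp add: wins_starL_sum_Node_other)
    with reply False show ?thesis
      by (auto simp: fset_of_list_elem opponent_if_neq)
  qed
qed

theorem theorem3p3:
  fixes as :: "nat list"
  assumes "length as \<ge> 1"
  shows "Node (fset_of_list (map starL as)) \<simeq> starL (mex (set as))"
proof -
  let ?G = "Node (fset_of_list (map starL as))"
  have "as \<noteq> []"
    using assms by auto
  then have "wins w p (?G \<oplus> X) \<longleftrightarrow> wins w p (starL (mex (set as)) \<oplus> X)" for w p X
    \<comment> \<open>For the converse, if \<open>w\<close> did not win the \<open>starL\<close>
      sum, the other player would, and hence would win \<open>?G \<oplus> X\<close> too.\<close>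
    by (cases w) (metis wins_Node_starL_sum wins_determined)+
  then show ?thesis
    by (simp add: game_equiv_def outcome_def)
qed

end
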